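(* Let $\Phi$ and $\Psi$ be two homogeneous iterated function systems on $\mathbb{R}$, both satisfying the open set condition, whose common contraction factors are opposite (i.e. if $\rho\in(-1,1)\setminus\{0\}$ is the common contraction factor of $\Phi$, then $-\rho$ is the common contraction factor of $\Psi$), and having the same attractor $K\subset\mathbb{R}$. Then $K$ is symmetric, i.e. there exists $c\in\mathbb{R}$ such that $K=c-K:=\{c-x: x\in K\}$.
   Context: An iterated function system (IFS) on $\mathbb{R}$ is a finite set $\Phi=\{\phi_i\}_{i=1}^m$, $m\ge 2$, of distinct contractive similarities of $\mathbb{R}$. Its attractor is the unique nonempty compact set $K\subset\mathbb{R}$ with $K=\bigcup_{i=1}^m\phi_i(K)$. It is assumed throughout that $K$ is not a singleton. The IFS $\Phi$ is homogeneous if each map has the form $\phi_i(x)=rx+b_i$ with a common contraction factor $r\in(-1,1)\setminus\{0\}$ (the same for all $i$, possibly negative) and distinct translations $b_i\in\mathbb{R}$. The IFS $\Phi$ satisfies the open set condition (OSC) if there exists a nonempty bounded open set $U\subseteq\mathbb{R}$ such that $\bigcup_{i=1}^m\phi_i(U)\subseteq U$ and the sets $\phi_i(U)$, $1\le i\le m$, are pairwise disjoint. The two IFSs may satisfy the OSC with different open sets, and they are not assumed a priori to have the same number of maps. *)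

theory Defs
  imports "HOL-Analysis.Analysis"
begin

definition contractive_similarity :: "(real \<Rightarrow> real) \<Rightarrow> bool" where
  "contractive_similarity f \<longleftrightarrow>
     (\<exists>s. 0 < s \<and> s < 1 \<and> (\<forall>x y. dist (f x) (f y) = s * dist x y))"

text \<open>
  An IFS is a set of maps, so its members are distinct by construction. In the homogeneous
  case this is the same as distinctness of the translations.
\<close>

definition IFS :: "(real \<Rightarrow> real) set \<Rightarrow> bool" where
  "IFS \<Phi> \<longleftrightarrow> finite \<Phi> \<and> 2 \<le> card \<Phi> \<and> (\<forall>\<phi>\<in>\<Phi>. contractive_similarity \<phi>)"

text \<open>
  The attractor is given as a relation; by Hutchinson's theorem exactly one such \<open>K\<close> exists
  for every IFS.
\<close>

definition is_attractor :: "(real \<Rightarrow> real) set \<Rightarrow> real set \<Rightarrow> bool" where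
  "is_attractor \<Phi> K \<longleftrightarrow> K \<noteq> {} \<and> compact K \<and> K = (\<Union>\<phi>\<in>\<Phi>. \<phi> ` K)"

text \<open>The common factor \<open>r\<close> is signed: it may be negative.\<close>

definition homogeneous_IFS :: "real \<Rightarrow> (real \<Rightarrow> real) set \<Rightarrow> bool" where
  "homogeneous_IFS r \<Phi> \<longleftrightarrow>
     IFS \<Phi> \<and> r \<in> {-1<..<1} - {0} \<and> (\<forall>\<phi>\<in>\<Phi>. \<exists>b. \<phi> = (\<lambda>x. r * x + b))"

definition open_set_condition :: "(real \<Rightarrow> real) set \<Rightarrow> bool" where
  "open_set_condition \<Phi> \<longleftrightarrow>
     (\<exists>U. U \<noteq> {} \<and> bounded U \<and> open U \<and> (\<Union>\<phi>\<in>\<Phi>. \<phi> ` U) \<subseteq> U \<and>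
        pairwise (\<lambda>\<phi> \<psi>. disjnt (\<phi> ` U) (\<psi> ` U)) \<Phi>)"

end

theory Submission
  imports Defs
begin

text \<open>
  Write \<open>K = A + \<rho>K = B - \<rho>K\<close> with finite digit sets \<open>A\<close> and \<open>B\<close>, where \<open>\<rho> > 0\<close>. By the open
  set condition the level-\<open>n\<close> digits of \<open>A\<close> are \<open>card A ^ n\<close> points separated by a multiple of
  \<open>\<rho> ^ n\<close>, so \<open>K\<close> cannot be a union of fewer than \<open>card A ^ n\<close> translates of \<open>\<plusminus>\<rho> ^ n K\<close>. Hence
  \<open>card A = card B\<close>, all sums of digits are direct, and the digit set of \<open>K\<close> for a given ratio
  with the minimal number of digits is unique: the leftmost digit at which two of them differ
  would have a redundant subpiece. Applied to the ratio \<open>-\<rho>\<^sup>2\<close> this gives \<open>A + \<rho>B = B - \<rho>A\<close>.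
  Shift the four summands to have minimum 0. If the decompositions differ, the smallest
  discrepancy \<open>z\<close> lies in \<open>(A - A) \<inter> \<rho>(A - A)\<close> or in \<open>(B - B) \<inter> \<rho>(B - B)\<close>, contradicting
  directness of \<open>A + \<rho>A\<close> or \<open>B - \<rho>B\<close>. So \<open>B\<close> is a translate both of \<open>A\<close> and of \<open>-A\<close>, and
  \<open>B = c - A\<close> turns \<open>K = B - \<rho>K\<close> into \<open>K = c - K\<close>.
\<close>

section \<open>Affine sums of digit sets and iterated digit expansions\<close>

definition affine_sum :: "real \<Rightarrow> real set \<Rightarrow> real set \<Rightarrow> real set" where
  "affine_sum r C S = (\<lambda>(c, x). c + r * x) ` (C \<times> S)"

text \<open>The map is the one whose image is \<open>affine_sum r C S\<close>, so for finite sets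
  directness can be read off from cardinalities alone.\<close>

abbreviation direct_affine_sum :: "real \<Rightarrow> real set \<Rightarrow> real set \<Rightarrow> bool" where
  "direct_affine_sum r C S \<equiv> inj_on (\<lambda>(c, x). c + r * x) (C \<times> S)"

text \<open>The level-\<open>n\<close> set is C + rC + ... + r^(n-1)C, the translations of all
  \<open>n\<close>-fold compositions of the maps x -> c + rx.\<close>

primrec digits :: "real \<Rightarrow> real set \<Rightarrow> nat \<Rightarrow> real set" where
  "digits r C 0 = {0}"
| "digits r C (Suc n) = affine_sum r C (digits r C n)"

lemma affine_sumI: "c \<in> C \<Longrightarrow> x \<in> S \<Longrightarrow> c + r * x \<in> affine_sum r C S"
  by (auto simp: affine_sum_def)

lemma affine_sumE:
  assumes "y \<in> affine_sum r C S"
  obtains c x where "c \<in> C" "x \<in> S" "y = c + r * x"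
  using assms by (auto simp: affine_sum_def)

lemma affine_sum_mono: "C \<subseteq> D \<Longrightarrow> affine_sum r C S \<subseteq> affine_sum r D S"
  by (auto simp: affine_sum_def)

lemma affine_sum_assoc:
  "affine_sum r C (affine_sum s E S) = affine_sum (r * s) (affine_sum r C E) S"
proof (intro equalityI subsetI)
  fix y assume "y \<in> affine_sum r C (affine_sum s E S)"
  then obtain c e x where "c \<in> C" "e \<in> E" "x \<in> S" "y = c + r * (e + s * x)"
    by (auto elim!: affine_sumE)
  moreover from this have "y = (c + r * e) + (r * s) * x" by (simp add: algebra_simps)
  ultimately show "y \<in> affine_sum (r * s) (affine_sum r C E) S"
    by (metis affine_sumI)
next
  fix y assume "y \<in> affine_sum (r * s) (affine_sum r C E) S"
  then obtain c e x where "c \<in> C" "e \<in> E" "x \<in> S" "y = (c + r * e) + (r * s) * x"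
    by (auto elim!: affine_sumE)
  moreover from this have "y = c + r * (e + s * x)" by (simp add: algebra_simps)
  ultimately show "y \<in> affine_sum r C (affine_sum s E S)"
    by (metis affine_sumI)
qed

lemma finite_affine_sum: "finite C \<Longrightarrow> finite S \<Longrightarrow> finite (affine_sum r C S)"
  by (simp add: affine_sum_def)

lemma card_affine_sum_le:
  "finite C \<Longrightarrow> finite S \<Longrightarrow> card (affine_sum r C S) \<le> card C * card S"
  unfolding affine_sum_def by (metis card_cartesian_product card_image_le finite_cartesian_product)

lemma direct_affine_sum_if_card:
  assumes "finite C" "finite S" "card C * card S \<le> card (affine_sum r C S)"
  shows "direct_affine_sum r C S"
proof (rule eq_card_imp_inj_on)
  show "card ((\<lambda>(c, x). c + r * x) ` (C \<times> S)) = card (C \<times> S)"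
    using assms card_affine_sum_le[of C S r]
    by (simp add: affine_sum_def card_cartesian_product)
qed (use assms in simp)

lemma direct_affine_sumD:
  assumes "direct_affine_sum r C S" "c \<in> C" "c' \<in> C" "x \<in> S" "x' \<in> S"
    and "c + r * x = c' + r * x'"
  shows "c = c'" "x = x'"
  using inj_onD[OF assms(1), of "(c, x)" "(c', x')"] assms by auto

lemma finite_digits: "finite C \<Longrightarrow> finite (digits r C n)"
  by (induction n) (auto intro: finite_affine_sum)

lemma card_digits_le:
  assumes "finite C"
  shows "card (digits r C n) \<le> card C ^ n"
proof (induction n)
  case (Suc n)
  have "card (digits r C (Suc n)) \<le> card C * card (digits r C n)"
    using assms by (simp add: card_affine_sum_le finite_digits)
  also have "\<dots> \<le> card C * card C ^ n" using Suc by simp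
  finally show ?case by simp
qed simp

lemma self_affine_digits:
  assumes "K = affine_sum r C K"
  shows "K = affine_sum (r ^ n) (digits r C n) K"
proof (induction n)
  case 0
  show ?case by (force simp: affine_sum_def)
next
  case (Suc n)
  have "K = affine_sum r C (affine_sum (r ^ n) (digits r C n) K)"
    using assms[symmetric] Suc[symmetric] by simp
  then show ?case by (simp only: affine_sum_assoc power_Suc digits.simps)
qed

section \<open>Disjointness, counting and separation under the open set condition\<close>

definition osc_digits :: "real \<Rightarrow> real set \<Rightarrow> real set \<Rightarrow> bool" where
  "osc_digits r A U \<longleftrightarrow> U \<noteq> {} \<and> open U \<and> (\<forall>a\<in>A. \<forall>u\<in>U. a + r * u \<in> U) \<and>
     (\<forall>a\<in>A. \<forall>a'\<in>A. \<forall>u\<in>U. \<forall>u'\<in>U. a + r * u = a' + r * u' \<longrightarrow> a = a')"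

lemma osc_digits_iterate:
  assumes osc: "osc_digits r A U" and "r \<noteq> 0" "t \<in> digits r A n" "u \<in> U"
  shows "t + r ^ n * u \<in> U"
  using assms(3)
proof (induction n arbitrary: t)
  case (Suc n)
  then obtain a s where "a \<in> A" "s \<in> digits r A n" "t = a + r * s" by (auto elim: affine_sumE)
  moreover from this have "a + r * (s + r ^ n * u) \<in> U"
    using Suc.IH osc by (simp add: osc_digits_def)
  ultimately show ?case by (simp add: algebra_simps)
qed (use assms in simp)

text \<open>Peel off the leading digit: what remains lies in \<open>U\<close> by
  \<open>osc_digits_iterate\<close>, so level-one disjointness identifies the leading digits, and
  cancelling \<open>r\<close> leaves the same claim one level down.\<close>

lemma osc_digits_disjoint:
  assumes osc: "osc_digits r A U" and r: "r \<noteq> 0"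
    and "t \<in> digits r A n" "t' \<in> digits r A n" "u \<in> U" "u' \<in> U"
    and "t + r ^ n * u = t' + r ^ n * u'"
  shows "t = t'"
  using assms(3,4,7)
proof (induction n arbitrary: t t')
  case (Suc n)
  obtain a s where t: "a \<in> A" "s \<in> digits r A n" "t = a + r * s"
    using Suc.prems by (auto elim: affine_sumE)
  obtain a' s' where t': "a' \<in> A" "s' \<in> digits r A n" "t' = a' + r * s'"
    using Suc.prems by (auto elim: affine_sumE)
  have eq: "a + r * (s + r ^ n * u) = a' + r * (s' + r ^ n * u')"
    using Suc.prems t t' by (simp add: algebra_simps)
  then have "a = a'"
    using osc t t' osc_digits_iterate[OF osc r] assms(5,6) unfolding osc_digits_def by blast
  then show ?case using eq t t' Suc.IH r by simp
qed simp

lemma osc_card_digits: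
  assumes osc: "osc_digits r A U" and r: "r \<noteq> 0" and "finite A"
  shows "card (digits r A n) = card A ^ n"
proof (induction n)
  case (Suc n)
  obtain u where u: "u \<in> U" using osc by (auto simp: osc_digits_def)
  \<comment> \<open>A coincidence of digit sums becomes a coincidence of image points once a fixed
    \<open>u\<close> from \<open>U\<close> is attached to both tails.\<close>
  have "direct_affine_sum r A (digits r A n)"
  proof (rule inj_onI, clarify)
    fix a s a' s' assume *: "a \<in> A" "s \<in> digits r A n" "a' \<in> A" "s' \<in> digits r A n"
      "a + r * s = a' + r * s'"
    then have "a + r * (s + r ^ n * u) = a' + r * (s' + r ^ n * u)"
      by (simp add: algebra_simps)
    then have "a = a'"
      using osc * osc_digits_iterate[OF osc r] u unfolding osc_digits_def by blast
    then show "a = a' \<and> s = s'" using * r by simp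
  qed
  then show ?case using Suc by (simp add: affine_sum_def card_image card_cartesian_product)
qed simp

text \<open>\<open>\<delta>\<close> is the radius of a ball inside \<open>U\<close>. The images of
  \<open>U\<close> at level \<open>n\<close> are disjoint and each contains a ball of radius
  \<open>\<delta> * \<bar>r\<bar> ^ n\<close>.\<close>

lemma osc_digits_separated:
  assumes osc: "osc_digits r A U" and r: "r \<noteq> 0"
  obtains \<delta> where "\<delta> > 0"
    "\<And>n t t'. t \<in> digits r A n \<Longrightarrow> t' \<in> digits r A n \<Longrightarrow> t \<noteq> t' \<Longrightarrow> \<delta> * \<bar>r\<bar> ^ n \<le> \<bar>t - t'\<bar>"
proof -
  obtain u \<delta> where u: "u \<in> U" "\<delta> > 0" "ball u \<delta> \<subseteq> U"
    using osc by (metis osc_digits_def equals0I openE)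
  have "\<delta> * \<bar>r\<bar> ^ n \<le> \<bar>t - t'\<bar>"
    if t: "t \<in> digits r A n" "t' \<in> digits r A n" "t \<noteq> t'" for n t t'
  proof (rule ccontr)
    assume "\<not> \<delta> * \<bar>r\<bar> ^ n \<le> \<bar>t - t'\<bar>"
    then have "\<bar>(t' - t) / r ^ n\<bar> < \<delta>"
      using r by (simp add: power_abs abs_divide field_simps abs_minus_commute)
    \<comment> \<open>This is the point of \<open>U\<close> that the map of \<open>t\<close> sends
      to the image of \<open>u\<close> under the map of \<open>t'\<close>, so the two images would
      meet.\<close>
    then have "u + (t' - t) / r ^ n \<in> U" using u by (auto simp: dist_real_def)
    moreover have "t + r ^ n * (u + (t' - t) / r ^ n) = t' + r ^ n * u"
      using r by (simp add: field_simps)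
    ultimately show False using osc_digits_disjoint[OF osc r t(1,2)] u t by blast
  qed
  then show thesis using that u by blast
qed

section \<open>A lower bound for the number of pieces, by counting\<close>

text \<open>Pigeonhole: half-open bins of width \<open>h\<close> hold at most one point each, and
  the bin indices range over an integer interval with 2 * ceil(D) + 3 elements.\<close>

lemma card_separated_le:
  fixes P :: "real set"
  assumes "h > 0" "D \<ge> 0"
    and sep: "\<And>x y. x \<in> P \<Longrightarrow> y \<in> P \<Longrightarrow> x \<noteq> y \<Longrightarrow> h \<le> \<bar>x - y\<bar>"
    and diam: "\<And>x y. x \<in> P \<Longrightarrow> y \<in> P \<Longrightarrow> \<bar>x - y\<bar> \<le> D * h"
  shows "card P \<le> 2 * nat \<lceil>D\<rceil> + 3"
proof (cases "P = {}")
  case False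
  then obtain p where p: "p \<in> P" by blast
  define f where "f x = \<lfloor>(x - p) / h\<rfloor>" for x
  have "inj_on f P"
  proof (rule inj_onI, rule ccontr)
    fix x y assume xy: "x \<in> P" "y \<in> P" "f x = f y" "x \<noteq> y"
    have "\<bar>(x - p) / h - (y - p) / h\<bar> < 1"
      using xy(3) unfolding f_def by linarith
    moreover have "(x - p) / h - (y - p) / h = (x - y) / h" using assms(1) by (simp add: field_simps)
    ultimately have "\<bar>x - y\<bar> < h" using assms(1) by (simp add: abs_divide)
    then show False using sep xy by fastforce
  qed
  moreover have "f ` P \<subseteq> {- \<lceil>D\<rceil> - 1..\<lceil>D\<rceil> + 1}"
  proof
    fix z assume "z \<in> f ` P"
    then obtain x where x: "x \<in> P" "z = f x" by blast
    have "\<bar>(x - p) / h\<bar> \<le> D" using diam[OF x(1) p] assms(1) by (simp add: abs_divide field_simps)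
    then have "- \<lceil>D\<rceil> - 1 \<le> f x" "f x \<le> \<lceil>D\<rceil> + 1" unfolding f_def by linarith+
    then show "z \<in> {- \<lceil>D\<rceil> - 1..\<lceil>D\<rceil> + 1}" using x(2) by simp
  qed
  ultimately have "card P \<le> card {- \<lceil>D\<rceil> - 1..\<lceil>D\<rceil> + 1}"
    by (metis card_inj_on_le finite_atLeastAtMost_int)
  also have "\<dots> \<le> 2 * nat \<lceil>D\<rceil> + 3" using assms(2) by simp
  finally show ?thesis .
qed simp

text \<open>A substitute for a lower bound on the dimension of \<open>K\<close>.\<close>

definition min_covering :: "real set \<Rightarrow> real \<Rightarrow> nat \<Rightarrow> bool" where
  "min_covering K q N \<longleftrightarrow>
     (\<forall>j r C. finite C \<longrightarrow> \<bar>r\<bar> = q ^ j \<longrightarrow> K = affine_sum r C K \<longrightarrow> N ^ j \<le> card C)"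

lemma min_coveringD:
  "min_covering K q N \<Longrightarrow> finite C \<Longrightarrow> \<bar>r\<bar> = q ^ j \<Longrightarrow> K = affine_sum r C K \<Longrightarrow> N ^ j \<le> card C"
  by (auto simp: min_covering_def)

text \<open>Iterating a too small \<open>C\<close> gives at most \<open>card C ^ k\<close> pieces
  for \<open>card A ^ (j * k)\<close> separated digits. A piece has diameter comparable to the
  separation, so it absorbs boundedly many digits, uniformly in \<open>k\<close>; exponential growth
  then gives a contradiction.\<close>

lemma osc_min_covering:
  assumes osc: "osc_digits \<rho> A U" and \<rho>: "\<rho> \<noteq> 0" and A: "finite A" "A \<noteq> {}"
    and K: "K = affine_sum \<rho> A K" "bounded K" "K \<noteq> {}"
  shows "min_covering K \<bar>\<rho>\<bar> (card A)"
  unfolding min_covering_def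
proof (intro allI impI, rule ccontr)
  fix j r C assume C: "finite C" and r: "\<bar>r\<bar> = \<bar>\<rho>\<bar> ^ j" and KC: "K = affine_sum r C K"
    and less: "\<not> card A ^ j \<le> card C"
  obtain \<delta> where \<delta>: "\<delta> > 0" and sep: "\<And>n t t'. t \<in> digits \<rho> A n \<Longrightarrow> t' \<in> digits \<rho> A n \<Longrightarrow>
      t \<noteq> t' \<Longrightarrow> \<delta> * \<bar>\<rho>\<bar> ^ n \<le> \<bar>t - t'\<bar>"
    using osc_digits_separated[OF osc \<rho>] by metis
  obtain M where M: "\<And>x y. x \<in> K \<Longrightarrow> y \<in> K \<Longrightarrow> \<bar>x - y\<bar> \<le> M"
    using K(2) bounded_two_points[of K] by (auto simp: dist_real_def)
  obtain x0 where x0: "x0 \<in> K" using K by blast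
  have M0: "M \<ge> 0" using M[OF x0 x0] by simp
  \<comment> \<open>The pigeonhole bound for diameter over separation; it does not depend on
    \<open>k\<close>.\<close>
  define L where "L = 2 * nat \<lceil>M / \<delta>\<rceil> + 3"
  have count: "card A ^ (j * k) \<le> card C ^ k * L" for k
  proof -
    let ?n = "j * k"
    \<comment> \<open>Each digit \<open>t\<close> is represented by one marker point of its piece.
      \<open>T c\<close> collects the digits whose marker falls into the piece of \<open>c\<close>;
      these sets may overlap, but they cover all digits.\<close>
    define T where "T c = {t \<in> digits \<rho> A ?n. t + \<rho> ^ ?n * x0 \<in> (\<lambda>x. c + r ^ k * x) ` K}" for c
    have rk: "\<bar>r ^ k\<bar> = \<bar>\<rho>\<bar> ^ ?n" by (simp add: power_abs r power_mult)
    have "digits \<rho> A ?n \<subseteq> (\<Union>c\<in>digits r C k. T c)"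
    proof
      fix t assume t: "t \<in> digits \<rho> A ?n"
      then have "t + \<rho> ^ ?n * x0 \<in> K"
        using self_affine_digits[OF K(1), of ?n] x0 affine_sumI by metis
      then have "t + \<rho> ^ ?n * x0 \<in> affine_sum (r ^ k) (digits r C k) K"
        using self_affine_digits[OF KC, of k, symmetric] by simp
      then show "t \<in> (\<Union>c\<in>digits r C k. T c)"
        using t by (fastforce simp: T_def elim!: affine_sumE)
    qed
    moreover have "finite (\<Union>c\<in>digits r C k. T c)"
      using A C by (auto simp: T_def finite_digits)
    ultimately have "card (digits \<rho> A ?n) \<le> card (\<Union>c\<in>digits r C k. T c)"
      by (rule card_mono[rotated])
    also have "\<dots> \<le> (\<Sum>c\<in>digits r C k. card (T c))"
      using C by (simp add: card_UN_le finite_digits)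
    also have "\<dots> \<le> (\<Sum>c\<in>digits r C k. L)"
    proof (rule sum_mono)
      fix c
      show "card (T c) \<le> L" unfolding L_def
      proof (rule card_separated_le)
        show "\<delta> * \<bar>\<rho>\<bar> ^ ?n > 0" "M / \<delta> \<ge> 0" using \<delta> \<rho> M0 by auto
        fix t t' assume t: "t \<in> T c" "t' \<in> T c"
        show "t \<noteq> t' \<Longrightarrow> \<delta> * \<bar>\<rho>\<bar> ^ ?n \<le> \<bar>t - t'\<bar>" using t sep by (simp add: T_def)
        from t obtain x y where xy: "x \<in> K" "y \<in> K"
          "t + \<rho> ^ ?n * x0 = c + r ^ k * x" "t' + \<rho> ^ ?n * x0 = c + r ^ k * y"
          by (auto simp: T_def)
        then have "t - t' = r ^ k * (x - y)" by (simp add: algebra_simps)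
        then have "\<bar>t - t'\<bar> = \<bar>\<rho>\<bar> ^ ?n * \<bar>x - y\<bar>" by (simp add: abs_mult rk)
        also have "\<dots> \<le> \<bar>\<rho>\<bar> ^ ?n * M" using M xy by (simp add: mult_left_mono)
        finally show "\<bar>t - t'\<bar> \<le> M / \<delta> * (\<delta> * \<bar>\<rho>\<bar> ^ ?n)" using \<delta> by (simp add: mult.commute)
      qed
    qed
    also have "\<dots> \<le> card C ^ k * L" using card_digits_le[OF C] by simp
    finally show ?thesis using osc_card_digits[OF osc \<rho> A(1)] by simp
  qed
  \<comment> \<open>In terms of \<open>p < 1\<close> the count says \<open>1 \<le> p ^ k * L\<close>
    for every \<open>k\<close>, which fails for large \<open>k\<close>.\<close>
  define p where "p = real (card C) / real (card A ^ j)"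
  have pos: "card A ^ j > 0" using A by (simp add: card_gt_0_iff)
  have p: "p < 1" "p \<ge> 0" using less pos unfolding p_def by (simp_all add: divide_simps)
  have L: "L > 0" by (simp add: L_def)
  obtain k where k: "p ^ k < 1 / real L"
    using real_arch_pow_inv[of "1 / real L" p] L p by auto
  have "real (card A ^ j) ^ k \<le> real (card C) ^ k * real L"
    using count[of k] by (metis of_nat_le_iff of_nat_mult of_nat_power power_mult)
  moreover have "real (card C) ^ k = p ^ k * real (card A ^ j) ^ k"
    using pos by (auto simp: p_def power_divide)
  ultimately have "real (card A ^ j) ^ k * 1 \<le> real (card A ^ j) ^ k * (p ^ k * real L)"
    by (simp only: mult_ac mult_1_right)
  moreover have "real (card A ^ j) ^ k > 0" using pos by simp
  ultimately have "1 \<le> p ^ k * real L" by (rule mult_le_cancel_left_pos[THEN iffD1, rotated])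
  then show False using k L by (simp add: field_simps)
qed

section \<open>Directness and uniqueness of minimal digit sets\<close>

text \<open>Minimality at level \<open>Suc k\<close> bounds the number of sums from below by the
  largest number of pairs possible, so no two pairs share a sum.\<close>

lemma minimal_digits_direct:
  assumes min: "min_covering K q N" and C: "finite C" "card C \<le> N ^ j"
    and r: "\<bar>r\<bar> = q ^ j" and K: "K = affine_sum r C K"
  shows "direct_affine_sum r C (digits r C k)"
proof (rule direct_affine_sum_if_card)
  have "\<bar>r ^ Suc k\<bar> = q ^ (j * Suc k)" by (metis r power_abs power_mult)
  then have "N ^ (j * Suc k) \<le> card (digits r C (Suc k))"
    using min_coveringD[OF min finite_digits[OF C(1)] _ self_affine_digits[OF K]] by blast
  moreover have "card C * card (digits r C k) \<le> N ^ j * N ^ (j * k)"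
  proof (rule mult_le_mono)
    have "card (digits r C k) \<le> card C ^ k" using C by (simp add: card_digits_le)
    also have "\<dots> \<le> (N ^ j) ^ k" using C by (simp add: power_mono)
    finally show "card (digits r C k) \<le> N ^ (j * k)" by (simp add: power_mult)
  qed (use C in simp)
  ultimately show "card C * card (digits r C k) \<le> card (affine_sum r C (digits r C k))"
    by (simp add: power_add)
qed (use C finite_digits in auto)

text \<open>If \<open>x\<close> were missing from \<open>D\<close>, a tiny subpiece at the left end
  of x + rK would be covered through digits of \<open>D\<close> left of \<open>x\<close>. These
  belong to \<open>C\<close> too, so that subpiece could be dropped from the expansion by
  \<open>C\<close>, against minimality.\<close>

lemma minimal_digits_agree:
  assumes min: "min_covering K q N" and q: "0 < q" "q < 1" and j: "j > 0"
    and C: "finite C" "card C \<le> N ^ j" and D: "finite D"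
    and r: "\<bar>r\<bar> = q ^ j" and K: "K = affine_sum r C K" "K = affine_sum r D K"
    and cpt: "compact K" "K \<noteq> {}"
    and x: "x \<in> C" and below: "\<And>c. c < x \<Longrightarrow> c \<in> C \<longleftrightarrow> c \<in> D"
  shows "x \<in> D"
proof (rule ccontr)
  assume xD: "x \<notin> D"
  obtain \<epsilon> where \<epsilon>: "\<epsilon> > 0" "\<And>d. d \<in> D \<Longrightarrow> \<epsilon> \<le> \<bar>d - x\<bar>"
    using finite_set_avoid[OF D, of x] xD by (metis dist_real_def abs_minus_commute)
  obtain M where M: "\<And>x y. x \<in> K \<Longrightarrow> y \<in> K \<Longrightarrow> \<bar>x - y\<bar> \<le> M"
    using compact_imp_bounded[OF cpt(1)] bounded_two_points[of K] by (auto simp: dist_real_def)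
  \<comment> \<open>Minimising \<open>r * y\<close> instead of \<open>y\<close> makes
    \<open>x + r * y0\<close> the left end of x + rK for either sign of \<open>r\<close>.\<close>
  obtain y0 where y0: "y0 \<in> K" "\<And>y. y \<in> K \<Longrightarrow> r * y0 \<le> r * y"
    using continuous_attains_inf[OF cpt, of "\<lambda>y. r * y"] by (auto intro: continuous_intros)
  have M0: "M \<ge> 0" using M[OF y0(1) y0(1)] by simp
  have r1: "\<bar>r\<bar> < 1" using r q j by (simp add: power_less_one_iff)
  \<comment> \<open>Dividing by \<open>M + 1\<close> keeps the bound meaningful if
    \<open>M = 0\<close>.\<close>
  obtain k where k: "\<bar>r\<bar> ^ k < \<epsilon> / (M + 1)"
    using real_arch_pow_inv[of "\<epsilon> / (M + 1)" "\<bar>r\<bar>"] \<epsilon> M0 r1 by auto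
  have small: "\<bar>r ^ Suc k * (y - z)\<bar> < \<epsilon>" if "y \<in> K" "z \<in> K" for y z
  proof -
    have "\<bar>r ^ Suc k * (y - z)\<bar> = \<bar>r\<bar> * (\<bar>r\<bar> ^ k * \<bar>y - z\<bar>)" by (simp add: abs_mult power_abs)
    also have "\<dots> \<le> 1 * (\<bar>r\<bar> ^ k * \<bar>y - z\<bar>)" by (rule mult_right_mono) (use r1 in auto)
    also have "\<dots> \<le> \<bar>r\<bar> ^ k * (M + 1)" using M[OF that] by (simp add: mult_left_mono)
    also have "\<dots> < \<epsilon>" using k M0 by (simp add: field_simps)
    finally show ?thesis .
  qed
  note Kk = self_affine_digits[OF K(1)]
  obtain e z where e: "e \<in> digits r C k" "z \<in> K" "y0 = e + r ^ k * z"
    using y0(1) Kk[of k] affine_sumE by metis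
  \<comment> \<open>The removed digit belongs to a level-\<open>Suc k\<close> subpiece containing
    the left end \<open>x + r * y0\<close>.\<close>
  define E where "E = digits r C (Suc k) - {x + r * e}"
  have xe: "x + r * e \<in> digits r C (Suc k)" using x e by (simp add: affine_sumI)
  have redundant: "x + r * e + r ^ Suc k * y \<in> affine_sum (r ^ Suc k) E K" if y: "y \<in> K" for y
  proof -
    let ?p = "x + r * e + r ^ Suc k * y"
    have "?p \<in> K" using Kk[of "Suc k"] xe y affine_sumI by metis
    then obtain d y' where d: "d \<in> D" "y' \<in> K" "?p = d + r * y'"
      using K(2) affine_sumE by metis
    obtain e' z' where e': "e' \<in> digits r C k" "z' \<in> K" "y' = e' + r ^ k * z'"
      using d(2) Kk[of k] affine_sumE by metis
    have "?p - (x + r * y0) = r ^ Suc k * (y - z)" using e by (simp add: algebra_simps)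
    \<comment> \<open>The point \<open>?p\<close> is within \<open>\<epsilon>\<close> of the left
      end, and \<open>r * y'\<close> is at least \<open>r * y0\<close>. The gap of \<open>D\<close>
      around \<open>x\<close> then pushes \<open>d\<close> strictly below \<open>x\<close>.\<close>
    then have "d < x + \<epsilon>" using small[OF y e(2)] y0(2)[OF d(2)] d(3) by linarith
    then have "d < x" using \<epsilon>(2)[OF d(1)] by linarith
    then have "d \<in> C" "d \<noteq> x" using below d by auto
    \<comment> \<open>Directness ensures that the replacement digit is not the removed one.\<close>
    moreover from this have "d + r * e' \<noteq> x + r * e"
      using direct_affine_sumD(1)[OF minimal_digits_direct[OF min C r K(1)]] x e e' by blast
    ultimately have "d + r * e' \<in> E" using e' by (simp add: E_def affine_sumI)
    moreover have "?p = (d + r * e') + r ^ Suc k * z'" using d e' by (simp add: algebra_simps)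
    ultimately show ?thesis using e'(2) affine_sumI by metis
  qed
  have "K \<subseteq> affine_sum (r ^ Suc k) E K"
  proof
    fix p assume "p \<in> K"
    then obtain c y where c: "c \<in> digits r C (Suc k)" "y \<in> K" "p = c + r ^ Suc k * y"
      using Kk[of "Suc k"] affine_sumE by metis
    show "p \<in> affine_sum (r ^ Suc k) E K"
    proof (cases "c = x + r * e")
      case True
      then show ?thesis using redundant c by simp
    next
      case False
      then have "c \<in> E" using c by (simp add: E_def)
      then show ?thesis using c affine_sumI by metis
    qed
  qed
  moreover have "affine_sum (r ^ Suc k) E K \<subseteq> K"
    using affine_sum_mono[of E "digits r C (Suc k)"] Kk[of "Suc k"] E_def by blast
  ultimately have KE: "K = affine_sum (r ^ Suc k) E K" by (rule equalityI)
  have fin: "finite (digits r C (Suc k))" using C finite_digits by blast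
  have "\<bar>r ^ Suc k\<bar> = q ^ (j * Suc k)" by (metis r power_abs power_mult)
  then have "N ^ (j * Suc k) \<le> card E"
    using min_coveringD[OF min _ _ KE] fin E_def by blast
  also have "card E < card (digits r C (Suc k))"
    using fin xe unfolding E_def by (rule card_Diff1_less)
  also have "\<dots> \<le> card C ^ Suc k" using C card_digits_le by blast
  also have "\<dots> \<le> (N ^ j) ^ Suc k" using C by (intro power_mono) auto
  also have "\<dots> = N ^ (j * Suc k)" by (metis power_mult)
  finally show False by simp
qed

text \<open>Below the least element of the symmetric difference the two sets agree, so
  \<open>minimal_digits_agree\<close> applies there in whichever direction is needed.\<close>

lemma minimal_digits_unique:
  assumes min: "min_covering K q N" and q: "0 < q" "q < 1" and j: "j > 0"
    and C: "finite C" "card C \<le> N ^ j" and D: "finite D" "card D \<le> N ^ j"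
    and r: "\<bar>r\<bar> = q ^ j" and K: "K = affine_sum r C K" "K = affine_sum r D K"
    and cpt: "compact K" "K \<noteq> {}"
  shows "C = D"
proof (rule ccontr)
  define S where "S = (C - D) \<union> (D - C)"
  assume "C \<noteq> D"
  then have S: "finite S" "S \<noteq> {}" using C D by (auto simp: S_def)
  define x where "x = Min S"
  have "x \<in> S" using S by (simp add: x_def)
  have below: "c \<in> C \<longleftrightarrow> c \<in> D" if "c < x" for c
  proof -
    have "c \<notin> S" using Min_le[OF S(1), of c] that unfolding x_def by linarith
    then show ?thesis by (auto simp: S_def)
  qed
  show False
    using minimal_digits_agree[OF min q j C D(1) r K cpt, of x]
      minimal_digits_agree[OF min q j D C(1) r K(2,1) cpt, of x] below \<open>x \<in> S\<close>
    by (auto simp: S_def)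
qed

section \<open>Comparing two direct decompositions of one finite set\<close>

text \<open>Write z = z + 0 as x + y in the other decomposition. If both terms were below
  \<open>z\<close>, they would lie in \<open>P\<close> and \<open>Q\<close> and give
  \<open>z\<close> a second representation there; hence y = z.\<close>

lemma direct_sum_first_discrepancy_aux:
  fixes P Q P' Q' :: "real set"
  assumes nonneg: "\<And>x. x \<in> P' \<union> Q' \<Longrightarrow> 0 \<le> x"
    and zero: "0 \<in> P" "0 \<in> Q"
    and inj: "inj_on (\<lambda>(x, y). x + y) (P \<times> Q)"
    and eq: "(\<lambda>(x, y). x + y) ` (P \<times> Q) = (\<lambda>(x, y). x + y) ` (P' \<times> Q')"
    and below: "\<And>x. x < z \<Longrightarrow> (x \<in> P \<longleftrightarrow> x \<in> P') \<and> (x \<in> Q \<longleftrightarrow> x \<in> Q')"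
    and z: "z \<in> P" "z \<notin> P'"
  shows "z \<in> Q'"
proof -
  have "(\<lambda>(x, y). x + y) (z, 0) \<in> (\<lambda>(x, y). x + y) ` (P \<times> Q)"
    using z zero by blast
  then obtain x y where xy: "x \<in> P'" "y \<in> Q'" "z = x + y" using eq by auto
  have "x \<ge> 0" "y \<ge> 0" using nonneg xy by auto
  have "x \<noteq> z" using xy z by blast
  then have "x < z" using xy \<open>y \<ge> 0\<close> by linarith
  then have "x \<in> P" using below xy by blast
  show ?thesis
  proof (cases "y < z")
    case True
    then have "y \<in> Q" using below xy by blast
    then have "(x, y) = (z, 0)"
      using inj_onD[OF inj, of "(x, y)" "(z, 0)"] xy \<open>x \<in> P\<close> z zero by simp
    then show ?thesis using \<open>x \<noteq> z\<close> by simp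
  next
    case False
    then have "y = z" using xy \<open>x \<ge> 0\<close> by linarith
    then show ?thesis using xy by simp
  qed
qed

lemma direct_sum_first_discrepancy:
  fixes P Q P' Q' :: "real set"
  assumes fin: "finite P" "finite Q" "finite P'" "finite Q'"
    and nonneg: "\<forall>x\<in>P \<union> Q \<union> P' \<union> Q'. 0 \<le> x"
    and zero: "0 \<in> P" "0 \<in> Q" "0 \<in> P'" "0 \<in> Q'"
    and inj: "inj_on (\<lambda>(x, y). x + y) (P \<times> Q)" "inj_on (\<lambda>(x, y). x + y) (P' \<times> Q')"
    and eq: "(\<lambda>(x, y). x + y) ` (P \<times> Q) = (\<lambda>(x, y). x + y) ` (P' \<times> Q')"
    and ne: "P \<noteq> P' \<or> Q \<noteq> Q'"
  obtains z where "z > 0" "z \<in> P \<and> z \<in> Q' \<or> z \<in> P' \<and> z \<in> Q"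
proof -
  have swap: "(\<lambda>(x, y). x + y) ` (X \<times> Y) = (\<lambda>(x, y). x + y) ` (Y \<times> X)" for X Y :: "real set"
    by (force simp: image_iff add.commute)
  have inj_swap: "inj_on (\<lambda>(x, y). x + y) (Y \<times> X)"
    if "inj_on (\<lambda>(x, y). x + y) (X \<times> Y)" for X Y :: "real set"
    using that by (fastforce simp: inj_on_def add.commute)
  define S where "S = (P - P') \<union> (P' - P) \<union> (Q - Q') \<union> (Q' - Q)"
  have S: "finite S" "S \<noteq> {}" using fin ne by (auto simp: S_def)
  define z where "z = Min S"
  have "z \<in> S" using S by (simp add: z_def)
  have below: "(x \<in> P \<longleftrightarrow> x \<in> P') \<and> (x \<in> Q \<longleftrightarrow> x \<in> Q')" if "x < z" for x
  proof -
    have "x \<notin> S" using Min_le[OF S(1), of x] that unfolding z_def by linarith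
    then show ?thesis by (auto simp: S_def)
  qed
  have below': "(x \<in> Q \<longleftrightarrow> x \<in> Q') \<and> (x \<in> P \<longleftrightarrow> x \<in> P')" if "x < z" for x
    using below[OF that] by blast
  have "z \<noteq> 0" using \<open>z \<in> S\<close> zero by (auto simp: S_def)
  moreover have "z \<ge> 0" using \<open>z \<in> S\<close> nonneg by (auto simp: S_def)
  ultimately have "z > 0" by simp
  \<comment> \<open>The four cases are one argument up to exchanging the two summands and the two
    decompositions.\<close>
  have "z \<in> Q'" if "z \<in> P - P'"
    using direct_sum_first_discrepancy_aux[of P' Q' P Q z] nonneg zero inj eq below that by auto
  moreover have "z \<in> Q" if "z \<in> P' - P"
    using direct_sum_first_discrepancy_aux[of P Q P' Q' z] nonneg zero inj eq below that by auto
  moreover have "z \<in> P'" if "z \<in> Q - Q'"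
    using direct_sum_first_discrepancy_aux[of Q' P' Q P z] nonneg zero inj_swap[OF inj(1)]
      eq swap[of P Q] swap[of P' Q'] below' that by auto
  moreover have "z \<in> P" if "z \<in> Q' - Q"
    using direct_sum_first_discrepancy_aux[of Q P Q' P' z] nonneg zero inj_swap[OF inj(2)]
      eq swap[of P Q] swap[of P' Q'] below' that by auto
  ultimately show thesis using that \<open>z > 0\<close> \<open>z \<in> S\<close> unfolding S_def by blast
qed

text \<open>A common element \<open>z > 0\<close> of \<open>P\<close> and \<open>Q'\<close>, or of
  \<open>P'\<close> and \<open>Q\<close>, is a difference in one digit set that is also \<rho> times
  a difference in the same set. Directness of \<open>A\<close> with itself, or of \<open>B\<close>
  with itself, excludes this.\<close>

lemma opposite_digits_symmetric:
  fixes A B :: "real set" and \<rho> :: real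
  assumes fin: "finite A" "finite B" and ne: "A \<noteq> {}" "B \<noteq> {}" and \<rho>: "\<rho> > 0"
    and AB: "direct_affine_sum \<rho> A B" and BA: "direct_affine_sum (- \<rho>) B A"
    and AA: "direct_affine_sum \<rho> A A" and BB: "direct_affine_sum (- \<rho>) B B"
    and eq: "affine_sum \<rho> A B = affine_sum (- \<rho>) B A"
  shows "B = (\<lambda>a. Max A + Min B - a) ` A"
proof -
  let ?a = "Min A" and ?a' = "Max A" and ?b = "Min B"
  note mem = Min_in[OF fin(1) ne(1)] Max_in[OF fin(1) ne(1)] Min_in[OF fin(2) ne(2)]
  note le = Min_le[OF fin(1)] Max_ge[OF fin(1)] Min_le[OF fin(2)]
  define P where "P = (\<lambda>a. a - ?a) ` A"
  define Q where "Q = (\<lambda>b. \<rho> * (b - ?b)) ` B"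
  define P' where "P' = (\<lambda>b. b - ?b) ` B"
  \<comment> \<open>\<open>Max A\<close> enters because the minimum of -\<rho>A is attained at the
    largest digit.\<close>
  define Q' where "Q' = (\<lambda>a. \<rho> * (?a' - a)) ` A"
  \<comment> \<open>Both sides are the minimum of the common sum set, so normalising the summands
    shifts both decompositions by the same amount.\<close>
  have mins: "?a + \<rho> * ?b = ?b - \<rho> * ?a'"
  proof (rule antisym)
    have "?b - \<rho> * ?a' \<in> affine_sum \<rho> A B" using eq mem affine_sumI[of ?b B ?a' A "- \<rho>"] by simp
    then obtain a b where "a \<in> A" "b \<in> B" "?b - \<rho> * ?a' = a + \<rho> * b" by (rule affine_sumE)
    then show "?a + \<rho> * ?b \<le> ?b - \<rho> * ?a'" using le \<rho> by (simp add: add_mono)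
    have "?a + \<rho> * ?b \<in> affine_sum (- \<rho>) B A" using eq mem affine_sumI by metis
    then obtain b a where ba: "b \<in> B" "a \<in> A" "?a + \<rho> * ?b = b + (- \<rho>) * a" by (rule affine_sumE)
    then have "?b \<le> b" "\<rho> * a \<le> \<rho> * ?a'" using le \<rho> by auto
    then show "?b - \<rho> * ?a' \<le> ?a + \<rho> * ?b" using ba by simp
  qed
  have "P = P' \<and> Q = Q'"
  proof (rule ccontr)
    assume "\<not> (P = P' \<and> Q = Q')"
    then have neq: "P \<noteq> P' \<or> Q \<noteq> Q'" by blast
    have "finite P" "finite Q" "finite P'" "finite Q'"
      using fin by (auto simp: P_def Q_def P'_def Q'_def)
    moreover have "\<forall>x\<in>P \<union> Q \<union> P' \<union> Q'. 0 \<le> x"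
      using le \<rho> by (auto simp: P_def Q_def P'_def Q'_def)
    moreover have "0 \<in> P" "0 \<in> Q" "0 \<in> P'" "0 \<in> Q'"
      using mem by (auto simp: P_def Q_def P'_def Q'_def image_iff)
    moreover have "inj_on (\<lambda>(x, y). x + y) (P \<times> Q)"
    proof (rule inj_onI, clarify)
      fix x y x' y' assume "x \<in> P" "y \<in> Q" "x' \<in> P" "y' \<in> Q" and e: "x + y = x' + y'"
      then obtain a b a' b' where *: "a \<in> A" "b \<in> B" "a' \<in> A" "b' \<in> B"
        "x = a - ?a" "y = \<rho> * (b - ?b)" "x' = a' - ?a" "y' = \<rho> * (b' - ?b)"
        by (auto simp: P_def Q_def)
      then have "a + \<rho> * b = a' + \<rho> * b'" using e by (simp add: algebra_simps)
      then have "a = a'" "b = b'" using direct_affine_sumD[OF AB] * by blast+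
      then show "x = x' \<and> y = y'" using * by simp
    qed
    moreover have "inj_on (\<lambda>(x, y). x + y) (P' \<times> Q')"
    proof (rule inj_onI, clarify)
      fix x y x' y' assume "x \<in> P'" "y \<in> Q'" "x' \<in> P'" "y' \<in> Q'" and e: "x + y = x' + y'"
      then obtain b a b' a' where *: "a \<in> A" "b \<in> B" "a' \<in> A" "b' \<in> B"
        "x = b - ?b" "y = \<rho> * (?a' - a)" "x' = b' - ?b" "y' = \<rho> * (?a' - a')"
        by (auto simp: P'_def Q'_def)
      then have "b + (- \<rho>) * a = b' + (- \<rho>) * a'" using e by (simp add: algebra_simps)
      then have "a = a'" "b = b'" using direct_affine_sumD[OF BA] * by blast+
      then show "x = x' \<and> y = y'" using * by simp
    qed
    moreover have "(\<lambda>(x, y). x + y) ` (P \<times> Q) = (\<lambda>(x, y). x + y) ` (P' \<times> Q')"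
    proof -
      have "(\<lambda>(x, y). x + y) ` (P \<times> Q) = (\<lambda>s. s - (?a + \<rho> * ?b)) ` affine_sum \<rho> A B"
        by (force simp: P_def Q_def affine_sum_def image_iff algebra_simps)
      also have "\<dots> = (\<lambda>s. s - (?b - \<rho> * ?a')) ` affine_sum (- \<rho>) B A"
        using eq mins by simp
      also have "\<dots> = (\<lambda>(x, y). x + y) ` (P' \<times> Q')"
        by (force simp: P'_def Q'_def affine_sum_def image_iff algebra_simps)
      finally show ?thesis .
    qed
    ultimately obtain z where z: "z > 0" "z \<in> P \<and> z \<in> Q' \<or> z \<in> P' \<and> z \<in> Q"
      using neq by (rule direct_sum_first_discrepancy[of P Q P' Q'])
    from z(2) show False
    proof
      assume "z \<in> P \<and> z \<in> Q'"
      then obtain a c where ac: "a \<in> A" "c \<in> A" "z = a - ?a" "z = \<rho> * (?a' - c)"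
        by (auto simp: P_def Q'_def)
      then have "a + \<rho> * c = ?a + \<rho> * ?a'" by (simp add: algebra_simps)
      then have "a = ?a" using direct_affine_sumD(1)[OF AA] ac mem by blast
      then show False using ac z by simp
    next
      assume "z \<in> P' \<and> z \<in> Q"
      then obtain b c where bc: "b \<in> B" "c \<in> B" "z = b - ?b" "z = \<rho> * (c - ?b)"
        by (auto simp: P'_def Q_def)
      then have "b + (- \<rho>) * c = ?b + (- \<rho>) * ?b" by (simp add: algebra_simps)
      then have "b = ?b" using direct_affine_sumD(1)[OF BB] bc mem by blast
      then show False using bc z by simp
    qed
  qed
  then have "Q = Q'" by simp
  \<comment> \<open>Divided by \<open>\<rho>\<close>, the equality \<open>Q = Q'\<close> reads B -
    min B = max A - A.\<close>
  have "B = (\<lambda>q. ?b + q / \<rho>) ` Q" using \<rho> by (simp add: Q_def image_image)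
  also have "\<dots> = (\<lambda>a. ?a' + ?b - a) ` A"
    unfolding \<open>Q = Q'\<close> Q'_def image_image by (rule image_cong) (use \<rho> in simp_all)
  finally show ?thesis .
qed

section \<open>From iterated function systems to digits, and the conclusion\<close>

lemma homogeneous_IFS_digits:
  assumes \<Phi>: "homogeneous_IFS r \<Phi>" and osc: "open_set_condition \<Phi>" and K: "is_attractor \<Phi> K"
  obtains A U where "finite A" "A \<noteq> {}" "osc_digits r A U" "K = affine_sum r A K"
proof -
  \<comment> \<open>The value at 0 is the translation part, which determines a map of known
    ratio.\<close>
  define A where "A = (\<lambda>\<phi>. \<phi> 0) ` \<Phi>"
  have form: "\<phi> = (\<lambda>x. \<phi> 0 + r * x)" if \<phi>: "\<phi> \<in> \<Phi>" for \<phi>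
  proof -
    obtain b where b: "\<phi> = (\<lambda>x. r * x + b)" using \<Phi> \<phi> by (auto simp: homogeneous_IFS_def)
    show ?thesis unfolding b by (simp add: add.commute)
  qed
  have "finite A" using \<Phi> by (simp add: A_def homogeneous_IFS_def IFS_def)
  moreover have "A \<noteq> {}" using \<Phi> by (auto simp: A_def homogeneous_IFS_def IFS_def)
  moreover have "K = affine_sum r A K"
  proof -
    have "K = (\<Union>\<phi>\<in>\<Phi>. \<phi> ` K)" using K unfolding is_attractor_def by blast
    also have "\<dots> = (\<Union>\<phi>\<in>\<Phi>. (\<lambda>x. \<phi> 0 + r * x) ` K)" 
      using arg_cong[OF form, of _ "\<lambda>f. f ` K"] by (intro SUP_cong refl)
    also have "\<dots> = affine_sum r A K" by (auto simp: affine_sum_def A_def)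
    finally show ?thesis .
  qed
  moreover obtain U where U: "U \<noteq> {}" "open U" "(\<Union>\<phi>\<in>\<Phi>. \<phi> ` U) \<subseteq> U"
    "pairwise (\<lambda>\<phi> \<psi>. disjnt (\<phi> ` U) (\<psi> ` U)) \<Phi>"
    using osc unfolding open_set_condition_def by blast
  have "osc_digits r A U"
    unfolding osc_digits_def
  proof (intro conjI ballI impI)
    fix a u assume "a \<in> A" "u \<in> U"
    then obtain \<phi> where "\<phi> \<in> \<Phi>" "a = \<phi> 0" by (auto simp: A_def)
    then have "a + r * u = \<phi> u" using form by metis
    then show "a + r * u \<in> U" using U(3) \<open>\<phi> \<in> \<Phi>\<close> \<open>u \<in> U\<close> by auto
  next
    fix a a' u u' assume *: "a \<in> A" "a' \<in> A" "u \<in> U" "u' \<in> U" "a + r * u = a' + r * u'"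
    then obtain \<phi> \<psi> where \<phi>: "\<phi> \<in> \<Phi>" "a = \<phi> 0" "\<psi> \<in> \<Phi>" "a' = \<psi> 0" by (auto simp: A_def)
    then have "\<phi> u = \<psi> u'" using form *(5) by metis
    then have "\<not> disjnt (\<phi> ` U) (\<psi> ` U)" using *(3,4) by (auto simp: disjnt_iff)
    then have "\<phi> = \<psi>" using U(4) \<phi> by (auto simp: pairwise_def)
    then show "a = a'" using \<phi> by simp
  qed (use U in auto)
  ultimately show thesis using that by blast
qed

lemma symmetric_if_opposite_positive:
  assumes IFS: "homogeneous_IFS \<rho> \<Phi>" "homogeneous_IFS (- \<rho>) \<Psi>"
    and osc: "open_set_condition \<Phi>" "open_set_condition \<Psi>"
    and attr: "is_attractor \<Phi> K" "is_attractor \<Psi> K"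
    and pos: "\<rho> > 0"
  shows "\<exists>c. K = (\<lambda>x. c - x) ` K"
proof -
  obtain A U where A: "finite A" "A \<noteq> {}" "osc_digits \<rho> A U" "K = affine_sum \<rho> A K"
    using homogeneous_IFS_digits[OF IFS(1) osc(1) attr(1)] by metis
  obtain B V where B: "finite B" "B \<noteq> {}" "osc_digits (- \<rho>) B V" "K = affine_sum (- \<rho>) B K"
    using homogeneous_IFS_digits[OF IFS(2) osc(2) attr(2)] by metis
  have \<rho>: "\<rho> < 1" using IFS by (simp add: homogeneous_IFS_def)
  have K: "compact K" "K \<noteq> {}" using attr by (auto simp: is_attractor_def)
  have minA: "min_covering K \<rho> (card A)"
    using osc_min_covering[OF A(3) _ A(1,2,4)] pos K compact_imp_bounded by auto
  have minB: "min_covering K \<rho> (card B)"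
    using osc_min_covering[OF B(3) _ B(1,2,4)] pos K compact_imp_bounded by auto
  \<comment> \<open>Each digit set is a competitor, at exponent 1, in the minimality of the
    other.\<close>
  have card: "card A = card B"
    using min_coveringD[OF minA B(1) _ B(4), of 1] min_coveringD[OF minB A(1) _ A(4), of 1] pos
    by simp
  \<comment> \<open>Composing two expansions of \<open>K\<close> gives one of ratio
    \<open>r * s\<close>, of modulus \<open>\<rho> ^ 2\<close>. Minimality requires at least
    \<open>card A ^ 2\<close> digits, exactly the number of pairs.\<close>
  have direct: "direct_affine_sum r X Y \<and> card (affine_sum r X Y) \<le> card A ^ 2 \<and>
      affine_sum (r * s) (affine_sum r X Y) K = K"
    if K_eq: "affine_sum r X K = K" "affine_sum s Y K = K" and fin: "finite X" "finite Y"
      and cards: "card X = card A" "card Y = card A" and abs: "\<bar>r\<bar> = \<rho>" "\<bar>s\<bar> = \<rho>" for r s X Y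
  proof (intro conjI)
    show 1: "affine_sum (r * s) (affine_sum r X Y) K = K"
      using K_eq by (simp flip: affine_sum_assoc)
    have "\<bar>r * s\<bar> = \<rho> ^ 2" using abs by (simp add: abs_mult power2_eq_square)
    then have "card A ^ 2 \<le> card (affine_sum r X Y)"
      by (rule min_coveringD[OF minA finite_affine_sum[OF fin] _ 1[symmetric]])
    then show "direct_affine_sum r X Y"
      using fin cards by (intro direct_affine_sum_if_card) (simp_all add: power2_eq_square)
    show "card (affine_sum r X Y) \<le> card A ^ 2"
      using card_affine_sum_le[OF fin, of r] cards by (simp add: power2_eq_square)
  qed
  note KA = A(4)[symmetric] and KB = B(4)[symmetric]
  have abs: "\<bar>\<rho>\<bar> = \<rho>" "\<bar>- \<rho>\<bar> = \<rho>" using pos by auto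
  note dAB = direct[OF KA KB A(1) B(1) refl card[symmetric] abs]
    and dBA = direct[OF KB KA B(1) A(1) card[symmetric] refl abs(2,1)]
    and dAA = direct[OF KA KA A(1) A(1) refl refl abs(1,1)]
    and dBB = direct[OF KB KB B(1) B(1) card[symmetric] card[symmetric] abs(2,2)]
  \<comment> \<open>Composing in either order gives the ratio -\<rho>^2, so these are two minimal
    digit sets of \<open>K\<close> for one ratio.\<close>
  have "affine_sum \<rho> A B = affine_sum (- \<rho>) B A"
  proof (rule minimal_digits_unique[OF minA pos \<rho>, where j = 2 and r = "- (\<rho> * \<rho>)"])
    show "K = affine_sum (- (\<rho> * \<rho>)) (affine_sum \<rho> A B) K"
      and "K = affine_sum (- (\<rho> * \<rho>)) (affine_sum (- \<rho>) B A) K"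
      using dAB dBA by simp_all
    show "card (affine_sum \<rho> A B) \<le> card A ^ 2" "card (affine_sum (- \<rho>) B A) \<le> card A ^ 2"
      using dAB dBA by simp_all
  qed (use A(1) B(1) K finite_affine_sum in \<open>auto simp: power2_eq_square\<close>)
  then have sym: "B = (\<lambda>a. Max A + Min B - a) ` A"
    using dAB dBA dAA dBB
    by (intro opposite_digits_symmetric[OF A(1) B(1) A(2) B(2) pos]) simp_all
  let ?c = "Max A + Min B"
  \<comment> \<open>With B = c - A, the expansion B - \<rho>K becomes c - (A + \<rho>K) = c -
    K.\<close>
  have "K = affine_sum (- \<rho>) ((\<lambda>a. ?c - a) ` A) K" by (subst sym[symmetric]) (rule B(4))
  also have "\<dots> = (\<lambda>x. ?c - x) ` affine_sum \<rho> A K"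
    by (force simp: affine_sum_def image_iff algebra_simps)
  also have "\<dots> = (\<lambda>x. ?c - x) ` K" by (simp only: KA)
  finally show ?thesis by blast
qed

theorem theorem1p1:
  fixes \<Phi> \<Psi> :: "(real \<Rightarrow> real) set" and \<rho> :: real and K :: "real set"
  assumes "homogeneous_IFS \<rho> \<Phi>" and "homogeneous_IFS (- \<rho>) \<Psi>"
    and "open_set_condition \<Phi>" and "open_set_condition \<Psi>"
    and "is_attractor \<Phi> K" and "is_attractor \<Psi> K"
    and "\<not> is_singleton K"
  shows "\<exists>c. K = (\<lambda>x. c - x) ` K"
proof (cases "\<rho> > 0")
  case True
  then show ?thesis using symmetric_if_opposite_positive assms by blast
next
  case False
  \<comment> \<open>For negative \<open>\<rho>\<close> the two systems exchange roles.\<close>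
  then have "- \<rho> > 0" using assms(1) by (auto simp: homogeneous_IFS_def)
  then show ?thesis
    using symmetric_if_opposite_positive[of "- \<rho>" \<Psi> \<Phi> K] assms by simp
qed

end
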